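(* Let $1\le n\le N$ and let $J(t)=\pi_n(H(t))\,\pi_n(H^{-1}(t))$, where $H(t)=G(t)G(t)^{\star}$. For any time $t\ge 0$, the eigenvalues of $J(t)$ are (real and) greater than or equal to one.
   Context: $G$ is the left-invariant Brownian motion on $GL(N,\mathbb{C})$, $N\ge1$: the unique strong solution of $dG(t)=G(t)\,d\mathcal{Z}(t)$, $G(0)=G_0\in GL(N,\mathbb{C})$, where $\mathcal{Z}$ is an $N\times N$ complex Brownian matrix with independent complex Brownian entries, each satisfying $\mathbb{E}|\mathcal{Z}_{ij}(t)|^2=t/N$. Thus $H=GG^{\star}$ takes values in the positive definite Hermitian $N\times N$ matrices. For an $N\times N$ matrix $A$, $\pi_n(A)$ denotes its upper-left $n\times n$ corner. The eigenvalues of $J(t)$ are real since they coincide with those of the Hermitian matrix $[\pi_n(H^{-1}(t))]^{1/2}\pi_n(H(t))[\pi_n(H^{-1}(t))]^{1/2}$. *)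

theory Defs
  imports
    "HOL-Probability.Probability"
    "Jordan_Normal_Form.Gauss_Jordan_Elimination"
    "Jordan_Normal_Form.Char_Poly"
    "Jordan_Normal_Form.Schur_Decomposition"
begin

section \<open>Brownian motion\<close>

definition process_events ::
  "'w measure \<Rightarrow> real set \<Rightarrow> (real \<Rightarrow> 'w \<Rightarrow> 'b::topological_space) \<Rightarrow> 'w set set" where
  "process_events M T X =
     sigma_sets (space M) {X s -` A \<inter> space M | s A. s \<in> T \<and> A \<in> sets borel}"

definition real_brownian_motion :: "'w measure \<Rightarrow> real \<Rightarrow> (real \<Rightarrow> 'w \<Rightarrow> real) \<Rightarrow> bool" where
  "real_brownian_motion M v B \<longleftrightarrow>
     prob_space M \<and>
     (\<forall>t\<ge>0. B t \<in> borel_measurable M) \<and>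
     (\<forall>\<omega>\<in>space M. B 0 \<omega> = 0 \<and> continuous_on {0..} (\<lambda>t. B t \<omega>)) \<and>
     (\<forall>s t. 0 \<le> s \<longrightarrow> s < t \<longrightarrow>
        distributed M lborel (\<lambda>\<omega>. B t \<omega> - B s \<omega>)
          (\<lambda>x. ennreal (normal_density 0 (sqrt (v * (t - s))) x))) \<and>
     (\<forall>(\<tau>::nat \<Rightarrow> real) k. 0 \<le> \<tau> 0 \<longrightarrow> incseq \<tau> \<longrightarrow>
        prob_space.indep_vars M (\<lambda>_. borel) (\<lambda>i \<omega>. B (\<tau> (Suc i)) \<omega> - B (\<tau> i) \<omega>) {..<k})"

text \<open>
  Real and imaginary part are independent real Brownian motions with the same variance
  parameter, which is otherwise left open here.
\<close>

definition complex_brownian_motion :: "'w measure \<Rightarrow> (real \<Rightarrow> 'w \<Rightarrow> complex) \<Rightarrow> bool" where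
  "complex_brownian_motion M W \<longleftrightarrow>
     (\<exists>v>0. real_brownian_motion M v (\<lambda>t \<omega>. Re (W t \<omega>)) \<and>
            real_brownian_motion M v (\<lambda>t \<omega>. Im (W t \<omega>)) \<and>
            prob_space.indep_set M
              (process_events M {0..} (\<lambda>t \<omega>. Re (W t \<omega>)))
              (process_events M {0..} (\<lambda>t \<omega>. Im (W t \<omega>))))"

definition complex_brownian_matrix :: "'w measure \<Rightarrow> nat \<Rightarrow> (real \<Rightarrow> 'w \<Rightarrow> complex mat) \<Rightarrow> bool" where
  "complex_brownian_matrix M N Z \<longleftrightarrow>
     prob_space M \<and>
     (\<forall>t\<ge>0. \<forall>\<omega>\<in>space M. Z t \<omega> \<in> carrier_mat N N) \<and>
     (\<forall>i<N. \<forall>j<N. complex_brownian_motion M (\<lambda>t \<omega>. Z t \<omega> $$ (i, j))) \<and>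
     (\<forall>i<N. \<forall>j<N. \<forall>t\<ge>0.
        prob_space.expectation M (\<lambda>\<omega>. (cmod (Z t \<omega> $$ (i, j)))\<^sup>2) = t / real N) \<and>
     prob_space.indep_sets M
       (\<lambda>(i, j). process_events M {0..} (\<lambda>t \<omega>. Z t \<omega> $$ (i, j)))
       ({..<N} \<times> {..<N})"


section \<open>It\^o integral\<close>

definition simple_process ::
  "(real \<Rightarrow> 'w measure) \<Rightarrow> real \<Rightarrow> nat \<Rightarrow> (nat \<Rightarrow> real) \<Rightarrow> (nat \<Rightarrow> 'w \<Rightarrow> complex) \<Rightarrow> bool" where
  "simple_process F t k \<tau> \<xi> \<longleftrightarrow>
     \<tau> 0 = 0 \<and> \<tau> k = t \<and> (\<forall>i<k. \<tau> i \<le> \<tau> (Suc i)) \<and>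
     (\<forall>i<k. \<xi> i \<in> borel_measurable (F (\<tau> i)) \<and>
            (\<exists>C. \<forall>\<omega>\<in>space (F (\<tau> i)). cmod (\<xi> i \<omega>) \<le> C))"

definition simple_process_value ::
  "nat \<Rightarrow> (nat \<Rightarrow> real) \<Rightarrow> (nat \<Rightarrow> 'w \<Rightarrow> complex) \<Rightarrow> real \<Rightarrow> 'w \<Rightarrow> complex" where
  "simple_process_value k \<tau> \<xi> s \<omega> = (\<Sum>i<k. if s \<in> {\<tau> i<..\<tau> (Suc i)} then \<xi> i \<omega> else 0)"

definition simple_ito_integral ::
  "nat \<Rightarrow> (nat \<Rightarrow> real) \<Rightarrow> (nat \<Rightarrow> 'w \<Rightarrow> complex) \<Rightarrow> (real \<Rightarrow> 'w \<Rightarrow> complex) \<Rightarrow> 'w \<Rightarrow> complex" where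
  "simple_ito_integral k \<tau> \<xi> W \<omega> = (\<Sum>i<k. \<xi> i \<omega> * (W (\<tau> (Suc i)) \<omega> - W (\<tau> i) \<omega>))"

definition vanishes_in_probability :: "'w measure \<Rightarrow> (nat \<Rightarrow> 'w \<Rightarrow> ennreal) \<Rightarrow> bool" where
  "vanishes_in_probability M D \<longleftrightarrow>
     (\<forall>m. D m \<in> borel_measurable M) \<and>
     (\<forall>\<epsilon>>0::real. (\<lambda>m. measure M {\<omega> \<in> space M. ennreal \<epsilon> < D m \<omega>}) \<longlonglongrightarrow> 0)"

definition progressive_on :: "(real \<Rightarrow> 'w measure) \<Rightarrow> real \<Rightarrow> (real \<Rightarrow> 'w \<Rightarrow> complex) \<Rightarrow> bool" where
  "progressive_on F t X \<longleftrightarrow>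
     (\<forall>u\<in>{0..t}. (\<lambda>(s, \<omega>). X s \<omega>) \<in>
        borel_measurable (restrict_space borel {0..u} \<Otimes>\<^sub>M F u))"

text \<open>
  The random variable \<open>I\<close> is a version of the It\^o integral of \<open>X\<close> against the Brownian motion
  \<open>W\<close> over \<open>[0, t]\<close>: for some simple processes approximating \<open>X\<close> in \<open>L\<^sup>2([0, t])\<close>, in
  probability, their integrals converge to \<open>I\<close> in probability. The limit does not depend on
  the approximating sequence, up to null sets.
\<close>

definition has_ito_integral ::
  "'w measure \<Rightarrow> (real \<Rightarrow> 'w measure) \<Rightarrow> (real \<Rightarrow> 'w \<Rightarrow> complex) \<Rightarrow> (real \<Rightarrow> 'w \<Rightarrow> complex) \<Rightarrow>
   real \<Rightarrow> ('w \<Rightarrow> complex) \<Rightarrow> bool" where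
  "has_ito_integral M F X W t I \<longleftrightarrow>
     progressive_on F t X \<and>
     I \<in> borel_measurable M \<and>
     (\<exists>(k :: nat \<Rightarrow> nat) \<tau> \<xi>.
        (\<forall>m. simple_process F t (k m) (\<tau> m) (\<xi> m)) \<and>
        vanishes_in_probability M
          (\<lambda>m \<omega>. \<integral>\<^sup>+ s \<in> {0..t}.
             ennreal ((cmod (simple_process_value (k m) (\<tau> m) (\<xi> m) s \<omega> - X s \<omega>))\<^sup>2) \<partial>lborel) \<and>
        vanishes_in_probability M
          (\<lambda>m \<omega>. ennreal (cmod (simple_ito_integral (k m) (\<tau> m) (\<xi> m) W \<omega> - I \<omega>))))"


section \<open>Left-invariant Brownian motion on the general linear group\<close>

definition GL :: "nat \<Rightarrow> complex mat set" where
  "GL N = {A \<in> carrier_mat N N. invertible_mat A}"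

text \<open>The filtration generated by \<open>Z\<close>, augmented by the null sets.\<close>

definition augmented_filtration ::
  "'w measure \<Rightarrow> nat \<Rightarrow> (real \<Rightarrow> 'w \<Rightarrow> complex mat) \<Rightarrow> real \<Rightarrow> 'w measure" where
  "augmented_filtration M N Z t =
     sigma (space M)
       ((\<Union>i<N. \<Union>j<N. process_events M {0..t} (\<lambda>s \<omega>. Z s \<omega> $$ (i, j))) \<union> null_sets M)"

text \<open>
  \<open>G\<close> is a strong solution, with state space \<open>GL N\<close>, of \<open>dG = G dZ\<close>, \<open>G(0) = G0\<close>. As usual
  for a continuous process with a given state space, every path is continuous, starts at \<open>G0\<close> and
  stays in \<open>GL N\<close>; the integral equation holds almost surely.
\<close>

definition left_invariant_brownian_motion ::
  "'w measure \<Rightarrow> nat \<Rightarrow> (real \<Rightarrow> 'w \<Rightarrow> complex mat) \<Rightarrow> complex mat \<Rightarrow> (real \<Rightarrow> 'w \<Rightarrow> complex mat) \<Rightarrow> bool"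
where
  "left_invariant_brownian_motion M N Z G0 G \<longleftrightarrow>
     G0 \<in> GL N \<and>
     (\<forall>t\<ge>0. \<forall>\<omega>\<in>space M. G t \<omega> \<in> GL N) \<and>
     (\<forall>\<omega>\<in>space M. G 0 \<omega> = G0) \<and>
     (\<forall>i<N. \<forall>j<N.
        (\<forall>\<omega>\<in>space M. continuous_on {0..} (\<lambda>t. G t \<omega> $$ (i, j))) \<and>
        (\<forall>t\<ge>0. (\<lambda>\<omega>. G t \<omega> $$ (i, j)) \<in> borel_measurable (augmented_filtration M N Z t)) \<and>
        (\<forall>t\<ge>0. \<exists>I :: nat \<Rightarrow> 'w \<Rightarrow> complex.
           (\<forall>l<N. has_ito_integral M (augmented_filtration M N Z)
              (\<lambda>s \<omega>. G s \<omega> $$ (i, l)) (\<lambda>s \<omega>. Z s \<omega> $$ (l, j)) t (I l)) \<and>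
           (AE \<omega> in M. G t \<omega> $$ (i, j) = G0 $$ (i, j) + (\<Sum>l<N. I l \<omega>))))"


section \<open>The process of products of corners\<close>

definition corner :: "nat \<Rightarrow> complex mat \<Rightarrow> complex mat" where
  "corner n A = mat n n (\<lambda>(i, j). A $$ (i, j))"

definition H_process :: "(real \<Rightarrow> 'w \<Rightarrow> complex mat) \<Rightarrow> real \<Rightarrow> 'w \<Rightarrow> complex mat" where
  "H_process G t \<omega> = G t \<omega> * mat_adjoint (G t \<omega>)"

definition J_process :: "nat \<Rightarrow> (real \<Rightarrow> 'w \<Rightarrow> complex mat) \<Rightarrow> real \<Rightarrow> 'w \<Rightarrow> complex mat" where
  "J_process n G t \<omega> =
     corner n (H_process G t \<omega>) * corner n (the (mat_inverse (H_process G t \<omega>)))"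

end

theory Submission
  imports Defs
begin

text \<open>
  Let \<open>A\<close>, \<open>B\<close> be the corners of \<open>H\<close> and \<open>H\<inverse>\<close>, and \<open>A B v = z v\<close> with \<open>v \<noteq> 0\<close>. Put \<open>w = B v\<close> and
  extend \<open>v\<close>, \<open>w\<close> by zeros to \<open>x\<close>, \<open>y\<close>. Then \<open>b = \<langle>v, w\<rangle> = \<langle>x, H\<inverse> x\<rangle> > 0\<close> and
  \<open>\<langle>y, H y\<rangle> = \<langle>w, A w\<rangle> = z b\<close>, so that
  \<open>0 \<le> \<langle>y - H\<inverse> x, H (y - H\<inverse> x)\<rangle> = z b - 2 b + b = (z - 1) b\<close>.
\<close>

lemma mat_adjoint_carrier [simp, intro]:
  "A \<in> carrier_mat m n \<Longrightarrow> mat_adjoint A \<in> carrier_mat n m"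
  unfolding mat_adjoint_def by auto

lemma mat_adjoint_index:
  assumes "A \<in> carrier_mat m n" "i < n" "j < m"
  shows "mat_adjoint A $$ (i, j) = conjugate (A $$ (j, i))"
  using assms unfolding mat_adjoint_def by (simp add: mat_of_rows_index)

lemma cscalar_prod_mat_adjoint:
  fixes A :: "'a :: conjugatable_field mat"
  assumes A: "A \<in> carrier_mat m n" and u: "u \<in> carrier_vec n" and v: "v \<in> carrier_vec m"
  shows "(A *\<^sub>v u) \<bullet>c v = u \<bullet>c (mat_adjoint A *\<^sub>v v)"
proof -
  have "(A *\<^sub>v u) \<bullet>c v = (\<Sum>i<m. \<Sum>j<n. A $$ (i, j) * u $ j * conjugate (v $ i))"
    using A u v by (simp add: scalar_prod_def atLeast0LessThan sum_distrib_right)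
  also have "\<dots> = (\<Sum>j<n. \<Sum>i<m. A $$ (i, j) * u $ j * conjugate (v $ i))"
    by (rule sum.swap)
  also have "\<dots> = (\<Sum>j<n. u $ j * conjugate (\<Sum>i<m. mat_adjoint A $$ (j, i) * v $ i))"
    using A by (simp add: sum_conjugate conjugate_dist_mul mat_adjoint_index
        sum_distrib_left mult_ac)
  also have "\<dots> = u \<bullet>c (mat_adjoint A *\<^sub>v v)"
    using A u v carrier_matD[OF mat_adjoint_carrier[OF A]]
    by (simp add: scalar_prod_def atLeast0LessThan)
  finally show ?thesis .
qed

lemma conjugate_cscalar_prod:
  fixes u v :: "'a :: conjugatable_field vec"
  assumes "u \<in> carrier_vec n" "v \<in> carrier_vec n"
  shows "conjugate (u \<bullet>c v) = v \<bullet>c u"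
  using assms by (metis carrier_vec_conjugate conjugate_id conjugate_sprod_vec comm_scalar_prod)

text \<open>Moving \<open>A\<close> across the scalar product turns the form of
  \<open>A * mat_adjoint A\<close> into an ordinary scalar product, so its nonnegativity needs no
  spectral theory or square root.\<close>

lemma cscalar_prod_gram:
  fixes A :: "'a :: conjugatable_field mat"
  assumes A: "A \<in> carrier_mat m n" and u: "u \<in> carrier_vec m" and v: "v \<in> carrier_vec m"
  shows "(mat_adjoint A *\<^sub>v u) \<bullet>c (mat_adjoint A *\<^sub>v v) = ((A * mat_adjoint A) *\<^sub>v u) \<bullet>c v"
proof -
  have A': "mat_adjoint A \<in> carrier_mat n m" using A by simp
  have "(mat_adjoint A *\<^sub>v u) \<bullet>c (mat_adjoint A *\<^sub>v v) = (A *\<^sub>v (mat_adjoint A *\<^sub>v u)) \<bullet>c v"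
    using cscalar_prod_mat_adjoint[OF A _ v, of "mat_adjoint A *\<^sub>v u"] A' u by simp
  then show ?thesis using assoc_mult_mat_vec[OF A A' u] by simp
qed

text \<open>Pairing with \<open>v\<close> shows that the adjoint of \<open>A\<close> sends
  \<open>v\<close> to zero. With a right inverse \<open>B\<close> of \<open>A\<close>,
  \<open>v = A (B v)\<close> is then orthogonal to itself.\<close>

lemma gram_mult_vec_eq_0:
  fixes A :: "'a :: conjugatable_ordered_field mat"
  assumes A: "A \<in> carrier_mat n n" "invertible_mat A"
    and v: "v \<in> carrier_vec n" and 0: "(A * mat_adjoint A) *\<^sub>v v = 0\<^sub>v n"
  shows "v = 0\<^sub>v n"
proof -
  have A': "mat_adjoint A \<in> carrier_mat n n" using A by simp
  have "(mat_adjoint A *\<^sub>v v) \<bullet>c (mat_adjoint A *\<^sub>v v) = 0"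
    using cscalar_prod_gram[OF A(1) v v] 0 v by simp
  then have A'v: "mat_adjoint A *\<^sub>v v = 0\<^sub>v n"
    using A' v conjugate_square_eq_0_vec[of "mat_adjoint A *\<^sub>v v" n] by simp
  obtain B where B: "A * B = 1\<^sub>m n" "B * A = 1\<^sub>m (dim_row B)"
    using A unfolding invertible_mat_def inverts_mat_def by auto
  \<comment> \<open>The shape of \<open>B\<close> is not given: comparing column counts, the first
    equation fixes its columns and the second its rows.\<close>
  have Bc: "B \<in> carrier_mat n n"
    by (metis A(1) B carrier_matD(2) carrier_matI index_mult_mat(3) index_one_mat(3))
  have "A *\<^sub>v (B *\<^sub>v v) = v"
    using assoc_mult_mat_vec[OF A(1) Bc v] B(1) v by simp
  then have "v \<bullet>c v = (B *\<^sub>v v) \<bullet>c (mat_adjoint A *\<^sub>v v)"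
    using cscalar_prod_mat_adjoint[OF A(1) _ v, of "B *\<^sub>v v"] Bc v by simp
  also have "\<dots> = 0" using A'v Bc v by simp
  finally show ?thesis using v by simp
qed

text \<open>A trivial kernel gives a nonzero determinant, so \<open>mat_inverse\<close> is not
  \<open>None\<close> and \<open>the (mat_inverse H)\<close> is the true inverse.\<close>

lemma mat_inverse_gram:
  fixes A :: "'a :: conjugatable_ordered_field mat"
  assumes A: "A \<in> carrier_mat n n" "invertible_mat A"
  defines "H \<equiv> A * mat_adjoint A"
  obtains K where "mat_inverse H = Some K" "K \<in> carrier_mat n n" "H * K = 1\<^sub>m n"
proof -
  have H: "H \<in> carrier_mat n n" unfolding H_def using A by auto
  have "det H \<noteq> 0"
    using det_0_iff_vec_prod_zero_field[OF H] gram_mult_vec_eq_0[OF A] unfolding H_def by blast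
  then have "mat_inverse H \<noteq> None"
    using mat_inverse(1)[OF H, of "()"] det_non_zero_imp_unit[OF H, of "()"] by blast
  then show ?thesis using mat_inverse(2)[OF H] that by blast
qed

text \<open>For \<open>dim_vec v \<le> N\<close> this is the isometric inclusion of the first
  coordinates. Its adjoint is truncation, which makes \<open>corner n A\<close> the compression of
  \<open>A\<close>.\<close>

definition pad_vec :: "nat \<Rightarrow> 'a :: zero vec \<Rightarrow> 'a vec" where
  "pad_vec N v = vec N (\<lambda>i. if i < dim_vec v then v $ i else 0)"

lemma pad_vec_carrier [simp, intro]: "pad_vec N v \<in> carrier_vec N"
  by (simp add: pad_vec_def)

lemma pad_vec_cscalar_prod:
  fixes v :: "'a :: conjugatable_ring vec"
  assumes "n \<le> N" "u \<in> carrier_vec N" "v \<in> carrier_vec n"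
  shows "u \<bullet>c pad_vec N v = vec n (($) u) \<bullet>c v"
proof -
  have "u \<bullet>c pad_vec N v = (\<Sum>i<N. u $ i * conjugate (if i < n then v $ i else 0))"
    using assms by (simp add: scalar_prod_def pad_vec_def atLeast0LessThan)
  also have "\<dots> = (\<Sum>i<n. u $ i * conjugate (if i < n then v $ i else 0))"
    using assms by (intro sum.mono_neutral_right) auto
  also have "\<dots> = vec n (($) u) \<bullet>c v"
    using assms by (simp add: scalar_prod_def atLeast0LessThan)
  finally show ?thesis .
qed

lemma pad_vec_cscalar_prod_pad_vec:
  fixes u v :: "'a :: conjugatable_ring vec"
  assumes "n \<le> N" "u \<in> carrier_vec n" "v \<in> carrier_vec n"
  shows "pad_vec N u \<bullet>c pad_vec N v = u \<bullet>c v"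
proof -
  have "vec n (($) (pad_vec N u)) = u"
    using assms by (intro eq_vecI) (auto simp: pad_vec_def)
  then show ?thesis using pad_vec_cscalar_prod[of n N "pad_vec N u" v] assms by simp
qed

lemma corner_carrier [simp, intro]: "corner n A \<in> carrier_mat n n"
  by (simp add: corner_def)

lemma corner_mult_vec:
  assumes "n \<le> N" "A \<in> carrier_mat N N" "u \<in> carrier_vec n"
  shows "corner n A *\<^sub>v u = vec n (($) (A *\<^sub>v pad_vec N u))"
proof (rule eq_vecI)
  fix i assume "i < dim_vec (vec n (($) (A *\<^sub>v pad_vec N u)))"
  then have i: "i < n" by simp
  have "(A *\<^sub>v pad_vec N u) $ i = (\<Sum>j<N. A $$ (i, j) * (if j < n then u $ j else 0))"
    using i assms by (simp add: scalar_prod_def pad_vec_def atLeast0LessThan)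
  also have "\<dots> = (\<Sum>j<n. A $$ (i, j) * (if j < n then u $ j else 0))"
    using assms by (intro sum.mono_neutral_right) auto
  also have "\<dots> = (corner n A *\<^sub>v u) $ i"
    using i assms by (simp add: scalar_prod_def corner_def atLeast0LessThan)
  finally show "(corner n A *\<^sub>v u) $ i = vec n (($) (A *\<^sub>v pad_vec N u)) $ i"
    using i by simp
qed (simp add: corner_def)

lemma corner_cscalar_prod:
  assumes "n \<le> N" "A \<in> carrier_mat N N" "u \<in> carrier_vec n" "v \<in> carrier_vec n"
  shows "(corner n A *\<^sub>v u) \<bullet>c v = (A *\<^sub>v pad_vec N u) \<bullet>c pad_vec N v"
  using assms by (simp add: corner_mult_vec pad_vec_cscalar_prod mult_mat_vec_carrier[of A N N])

lemma eigenvalue_corner_gram: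
  fixes A :: "complex mat"
  assumes A: "A \<in> carrier_mat N N" "invertible_mat A" and nN: "n \<le> N"
  defines "H \<equiv> A * mat_adjoint A"
  assumes ev: "eigenvalue (corner n H * corner n (the (mat_inverse H))) z"
  shows "z \<in> \<real> \<and> 1 \<le> Re z"
proof -
  obtain K where K: "mat_inverse H = Some K" and Kc: "K \<in> carrier_mat N N" and HK: "H * K = 1\<^sub>m N"
    using mat_inverse_gram[OF A] unfolding H_def by blast
  have A': "mat_adjoint A \<in> carrier_mat N N" using A by simp
  have H: "H \<in> carrier_mat N N" unfolding H_def using A by auto
  from ev K obtain v where v: "v \<in> carrier_vec n" "v \<noteq> 0\<^sub>v n"
    and eq: "(corner n H * corner n K) *\<^sub>v v = z \<cdot>\<^sub>v v"
    unfolding eigenvalue_def eigenvector_def by (auto simp: corner_def)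
  define w where "w = corner n K *\<^sub>v v"
  define x where "x = pad_vec N v"
  define y where "y = pad_vec N w"
  \<comment> \<open>As \<open>H\<close> is a Gram matrix, the \<open>H\<close>-form of a vector is
    the squared norm of its image under \<open>mat_adjoint A\<close>. Hence \<open>p - q\<close>
    stands for \<open>y - K x\<close>, where \<open>K\<close> inverts \<open>H\<close>.\<close>
  define p where "p = mat_adjoint A *\<^sub>v y"
  define q where "q = mat_adjoint A *\<^sub>v (K *\<^sub>v x)"
  have w: "w \<in> carrier_vec n" unfolding w_def by (rule mult_mat_vec_carrier[OF corner_carrier v(1)])
  have x: "x \<in> carrier_vec N" and y: "y \<in> carrier_vec N" unfolding x_def y_def by auto
  have Kx: "K *\<^sub>v x \<in> carrier_vec N" using Kc x by simp
  have p: "p \<in> carrier_vec N" and q: "q \<in> carrier_vec N"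
    unfolding p_def q_def using A' y Kx by simp_all
  have HKx: "H *\<^sub>v (K *\<^sub>v x) = x" using assoc_mult_mat_vec[OF H Kc x] HK x by simp
  have Hw: "corner n H *\<^sub>v w = z \<cdot>\<^sub>v v"
    using eq assoc_mult_mat_vec[of "corner n H" n n "corner n K" n v] v unfolding w_def by simp
  \<comment> \<open>That \<open>b\<close> is real is not known yet, so \<open>b\<close> and
    \<open>cnj b\<close> are kept apart until \<open>q \<bullet>c q = cnj b\<close> turns out
    positive.\<close>
  define b where "b = w \<bullet>c v"
  have vw: "v \<bullet>c w = cnj b"
    using conjugate_cscalar_prod[OF w v(1)] unfolding b_def by simp
  have b_K: "b = (K *\<^sub>v x) \<bullet>c x"
    unfolding b_def w_def x_def by (rule corner_cscalar_prod[OF nN Kc v(1) v(1)])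
  have qq: "q \<bullet>c q = cnj b"
    using cscalar_prod_gram[OF A(1) Kx Kx] HKx conjugate_cscalar_prod[OF Kx x] b_K
    unfolding q_def H_def by simp
  have qp: "q \<bullet>c p = cnj b"
    using cscalar_prod_gram[OF A(1) Kx y] HKx pad_vec_cscalar_prod_pad_vec[OF nN v(1) w] vw
    unfolding q_def p_def H_def x_def y_def by simp
  have pq: "p \<bullet>c q = b"
    using conjugate_cscalar_prod[OF q p] qp by simp
  have pp: "p \<bullet>c p = z * cnj b"
    using cscalar_prod_gram[OF A(1) y y] corner_cscalar_prod[OF nN H w w] Hw vw v w
    unfolding p_def H_def y_def by simp
  \<comment> \<open>Applying \<open>A\<close> to \<open>q\<close> gives \<open>H (K x) = x\<close>,
    so \<open>q = 0\<close> would force the eigenvector \<open>v\<close> to vanish.\<close>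
  have "q \<noteq> 0\<^sub>v N"
  proof
    assume "q = 0\<^sub>v N"
    then have "H *\<^sub>v (K *\<^sub>v x) = 0\<^sub>v N"
      unfolding H_def using assoc_mult_mat_vec[OF A(1) A' Kx] A(1) unfolding q_def by auto
    then have "x = 0\<^sub>v N" using HKx by simp
    then have "v \<bullet>c v = 0"
      using pad_vec_cscalar_prod_pad_vec[OF nN v(1) v(1)] unfolding x_def by simp
    then show False using v by simp
  qed
  then have "cnj b > 0" using conjugate_square_greater_0_vec[OF q] qq by simp
  then have b: "Im b = 0" "Re b > 0" by (auto simp: less_complex_def)
  \<comment> \<open>The order on complex numbers compares only numbers with equal imaginary parts,
    so \<open>0 \<le> z * cnj b\<close> with \<open>b\<close> real and positive makes
    \<open>z\<close> real.\<close>
  have "p \<bullet>c p \<ge> 0" using p by auto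
  then have "Im z = 0" using pp b by (auto simp: less_eq_complex_def)
  moreover have "(p - q) \<bullet>c (p - q) \<ge> 0" using p q by auto
  moreover have "(p - q) \<bullet>c (p - q) = p \<bullet>c p - p \<bullet>c q - (q \<bullet>c p - q \<bullet>c q)"
  proof -
    have "conjugate (p - q) = conjugate p - conjugate q"
      using p q by (intro eq_vecI) auto
    then show ?thesis
      using p q by (simp add: minus_scalar_prod_distrib[of _ N] scalar_prod_minus_distrib[of _ N])
  qed
  \<comment> \<open>In the expansion \<open>q \<bullet>c p\<close> and \<open>q \<bullet>c q\<close>
    cancel, both being \<open>cnj b\<close>; what remains is \<open>z * cnj b - b\<close>.\<close>
  ultimately have "(Re z - 1) * Re b \<ge> 0"
    using pp pq qp qq b by (auto simp: less_eq_complex_def algebra_simps)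
  then show ?thesis
    using b \<open>Im z = 0\<close> by (auto simp: complex_is_Real_iff zero_le_mult_iff)
qed

theorem lemma3p2:
  fixes M :: "'w measure"
    and N n :: nat
    and Z G :: "real \<Rightarrow> 'w \<Rightarrow> complex mat"
    and G0 :: "complex mat"
  assumes "1 \<le> n" and "n \<le> N"
    and "complex_brownian_matrix M N Z"
    and "left_invariant_brownian_motion M N Z G0 G"
  shows "\<forall>t\<ge>0. \<forall>\<omega>\<in>space M. \<forall>z. eigenvalue (J_process n G t \<omega>) z \<longrightarrow> z \<in> \<real> \<and> 1 \<le> Re z"
proof (intro allI ballI impI)
  fix t :: real and \<omega> z
  assume "0 \<le> t" "\<omega> \<in> space M" and ev: "eigenvalue (J_process n G t \<omega>) z"
  \<comment> \<open>Paths stay in \<open>GL N\<close> for every \<open>\<omega>\<close>, so the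
    matrix lemma applies pointwise, with no exceptional null set.\<close>
  then have "G t \<omega> \<in> carrier_mat N N" "invertible_mat (G t \<omega>)"
    using assms(4) unfolding left_invariant_brownian_motion_def GL_def by auto
  then show "z \<in> \<real> \<and> 1 \<le> Re z"
    using eigenvalue_corner_gram[OF _ _ assms(2)] ev unfolding J_process_def H_process_def by blast
qed

end
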